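(* Let $\{(x^k,n^k)\}$ be generated by the proximal block coordinate descent algorithm (see context) applied with $P=Q=F$. Suppose that the sequence $\{n^k\}$ is convergent and that the local stability condition holds. Then $(x^k,n^k)$ converges to a local minimum of $F$ over $\mathcal X\times\mathcal N$.
   Context: $\mathcal I,\mathcal J$ are finite index sets, $b>0$, $\mathcal X=\{x\in\{0,1\}^{|\mathcal I|}:\sum_{i\in\mathcal I} x_i\le p\}$, $\mathcal N=[0,b]^{|\mathcal J|}$, and $$F(x,n)=e+d^\top n+r^\top x+\sum_{j\in\mathcal J}h_j(n_j;\sigma_j)\sum_{i\in\mathcal I}q_{ij}\Psi\!\left(\frac{g_{ij}(x)}{h_j(n_j;\sigma_j)}\right),$$ with $e\in\mathbb R$, $d\in\mathbb R^{|\mathcal J|}$ (sampling costs), $r\in\mathbb R^{|\mathcal I|}$, $q_{ij}>0$, each $g_{ij}$ an affine function of $x$, and $\Psi(z)=z\Phi(z)+\phi(z)$, where $\Phi,\phi$ are the standard normal cdf and pdf. The functions $h_j$ satisfy: (i) $h_j(\cdot;\sigma_j)$ is finite, positive, strictly convex, decreasing and continuously differentiable on $[0,\infty)$ for any $\sigma_j$; (ii) $\frac{\partial h_j}{\partial\sigma_j}(n_j;\sigma_j)>0$ for all $n_j\ge0$; (iii) $\frac{\partial^2h_j}{\partial n_j\partial\sigma_j}(n_j;\sigma_j)<0$ for all $n_j\ge0$. Algorithm: given $n^0\in\mathcal N$ and parameters $\lambda_k>0$, for $k=0,1,2,\dots$: - $x$-step: $x^{k+1}=T(n^k)\in\arg\min_{x\in\mathcal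 X}P(x,n^k)$, where ties are broken lexicographically ($x^1$ is preferred to $x^2$ if there is an index $i^*$ with $x^1_{i^*}=1$, $x^2_{i^*}=0$ and $x^1_i=x^2_i$ for all $i<i^*$), so that $T:\mathcal N\to\mathcal X$ is single-valued; - $n$-step: $n^{k+1}\in\arg\min_{n\in\mathcal N}\{Q(x^{k+1},n)+\frac{\lambda_k}{2}\|n-n^k\|^2\}$. Local stability condition: if $\{n^k\}$ converges to $\bar n$, then there exist $\bar x\in\mathcal X$ and a sufficiently large $K$ such that $\bar x=T(n^k)\in\arg\min_{x\in\mathcal X}P(x,n^k)$ for all $k>K$. A point $(x^*,n^* )\in\mathcal X\times\mathcal N$ is a (blockwise) local minimum of $F$ if $x^*\in\arg\min_{x\in\mathcal X}F(x,n^* )$ and there is $\epsilon>0$ with $F(x^*,n^* )\le F(x^*,n)$ for all $n\in\mathcal N$ with $\|n-n^*\|<\epsilon$.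
   Formalization: The formal theorem additionally assumes that the sum of 1/λ_k diverges (true for every bounded sequence λ_k); with only λ_k > 0 the claim fails, e.g. for λ_k = 2^(k+1), where the iterates can stall before reaching a local minimum. *)

theory Defs
  imports "HOL-Probability.Probability"
begin

definition bin_set :: "real \<Rightarrow> (real ^ 'i::finite) set" where
  "bin_set p = {x. (\<forall>i. x $ i \<in> {0, 1}) \<and> (\<Sum>i\<in>UNIV. x $ i) \<le> p}"

definition box_set :: "real \<Rightarrow> (real ^ 'j::finite) set" where
  "box_set b = {n. \<forall>j. 0 \<le> n $ j \<and> n $ j \<le> b}"

definition affine_fun :: "(real ^ 'i::finite \<Rightarrow> real) \<Rightarrow> bool" where
  "affine_fun f \<longleftrightarrow> (\<exists>a c. \<forall>x. f x = a + c \<bullet> x)"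

definition Psi :: "real \<Rightarrow> real" where
  "Psi z = z * cdf std_normal_distribution z + std_normal_density z"

definition F_obj ::
  "real \<Rightarrow> real ^ 'j::finite \<Rightarrow> real ^ 'i::finite \<Rightarrow> ('i \<Rightarrow> 'j \<Rightarrow> real)
    \<Rightarrow> ('i \<Rightarrow> 'j \<Rightarrow> real ^ 'i \<Rightarrow> real) \<Rightarrow> ('j \<Rightarrow> real \<Rightarrow> real \<Rightarrow> real) \<Rightarrow> real ^ 'j
    \<Rightarrow> real ^ 'i \<Rightarrow> real ^ 'j \<Rightarrow> real" where
  "F_obj e d r q g h \<sigma> x n =
     e + d \<bullet> n + r \<bullet> x
       + (\<Sum>j\<in>UNIV. h j (n $ j) (\<sigma> $ j)
            * (\<Sum>i\<in>UNIV. q i j * Psi (g i j x / h j (n $ j) (\<sigma> $ j))))"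

definition strictly_convex_on :: "real set \<Rightarrow> (real \<Rightarrow> real) \<Rightarrow> bool" where
  "strictly_convex_on S f \<longleftrightarrow> convex S \<and>
     (\<forall>x\<in>S. \<forall>y\<in>S. \<forall>t. x \<noteq> y \<and> 0 < t \<and> t < 1 \<longrightarrow>
        f ((1 - t) * x + t * y) < (1 - t) * f x + t * f y)"

text \<open>Continuous differentiability relative to \<open>S\<close>: at a boundary point of an
  interval the derivative is the one-sided one.\<close>

definition C1_on :: "real set \<Rightarrow> (real \<Rightarrow> real) \<Rightarrow> bool" where
  "C1_on S f \<longleftrightarrow>
     (\<exists>f'. (\<forall>x\<in>S. (f has_real_derivative f' x) (at x within S)) \<and> continuous_on S f')"

text \<open>The conditions on one function \<open>h = (\<lambda>n s. h(n; s))\<close>. The parameter \<open>s\<close> ranges over an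
  open set \<open>S\<close> of admissible values (for instance all reals, or the positive reals); the
  derivative with respect to \<open>n\<close> is one-sided at \<open>n = 0\<close>. The mixed derivative is
  the derivative with respect to \<open>n\<close> of the derivative with respect to \<open>s\<close>.\<close>

definition h_conditions :: "real set \<Rightarrow> (real \<Rightarrow> real \<Rightarrow> real) \<Rightarrow> bool" where
  "h_conditions S h \<longleftrightarrow>
     (\<forall>s\<in>S. (\<forall>n\<ge>0. h n s > 0) \<and>
             strictly_convex_on {0..} (\<lambda>n. h n s) \<and>
             antimono_on {0..} (\<lambda>n. h n s) \<and>
             C1_on {0..} (\<lambda>n. h n s)) \<and>
     (\<forall>s\<in>S. \<forall>n\<ge>0. (\<lambda>t. h n t) differentiable (at s) \<and> deriv (\<lambda>t. h n t) s > 0) \<and>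
     (\<forall>s\<in>S. \<forall>n\<ge>0. \<exists>D<0.
        ((\<lambda>m. deriv (\<lambda>t. h m t) s) has_real_derivative D) (at n within {0..}))"

definition lex_preferred :: "real ^ ('i::{finite,linorder}) \<Rightarrow> real ^ ('i::{finite,linorder}) \<Rightarrow> bool" where
  "lex_preferred x1 x2 \<longleftrightarrow>
     (\<exists>i. x1 $ i = 1 \<and> x2 $ i = 0 \<and> (\<forall>i'<i. x1 $ i' = x2 $ i'))"

definition T_map ::
  "(real ^ ('i::{finite,linorder}) \<Rightarrow> real ^ 'j \<Rightarrow> real) \<Rightarrow> (real ^ ('i::{finite,linorder})) set \<Rightarrow> real ^ 'j::finite
    \<Rightarrow> real ^ ('i::{finite,linorder})" where
  "T_map P X n =
     (THE x. is_arg_min (\<lambda>x. P x n) (\<lambda>x. x \<in> X) x \<and>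
        (\<forall>y. is_arg_min (\<lambda>x. P x n) (\<lambda>x. x \<in> X) y \<and> y \<noteq> x \<longrightarrow> lex_preferred x y))"

text \<open>The algorithm produces \<open>x (Suc k)\<close> from \<open>n k\<close>; the value \<open>x 0\<close> is not used and is
  left unconstrained.\<close>

definition prox_bcd ::
  "(real ^ ('i::{finite,linorder}) \<Rightarrow> real ^ 'j \<Rightarrow> real) \<Rightarrow> (real ^ ('i::{finite,linorder}) \<Rightarrow> real ^ 'j \<Rightarrow> real)
    \<Rightarrow> (real ^ ('i::{finite,linorder})) set \<Rightarrow> (real ^ 'j) set \<Rightarrow> (nat \<Rightarrow> real)
    \<Rightarrow> (nat \<Rightarrow> real ^ ('i::{finite,linorder})) \<Rightarrow> (nat \<Rightarrow> real ^ 'j::finite) \<Rightarrow> bool" where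
  "prox_bcd P Q X N lam x n \<longleftrightarrow>
     n 0 \<in> N \<and>
     (\<forall>k. x (Suc k) = T_map P X (n k) \<and>
          is_arg_min (\<lambda>y. P y (n k)) (\<lambda>y. y \<in> X) (x (Suc k)) \<and>
          is_arg_min (\<lambda>m. Q (x (Suc k)) m + lam k / 2 * (norm (m - n k))\<^sup>2)
            (\<lambda>m. m \<in> N) (n (Suc k)))"

definition local_stability ::
  "(real ^ ('i::{finite,linorder}) \<Rightarrow> real ^ 'j \<Rightarrow> real) \<Rightarrow> (real ^ ('i::{finite,linorder})) set
    \<Rightarrow> (nat \<Rightarrow> real ^ 'j::finite) \<Rightarrow> bool" where
  "local_stability P X n \<longleftrightarrow>
     (\<forall>nbar. n \<longlonglongrightarrow> nbar \<longrightarrow>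
        (\<exists>xbar\<in>X. \<exists>K. \<forall>k>K. xbar = T_map P X (n k) \<and>
           is_arg_min (\<lambda>x. P x (n k)) (\<lambda>x. x \<in> X) xbar))"

definition block_local_min ::
  "(real ^ 'i::finite \<Rightarrow> real ^ 'j::finite \<Rightarrow> real) \<Rightarrow> (real ^ 'i) set \<Rightarrow> (real ^ 'j) set
    \<Rightarrow> real ^ 'i \<Rightarrow> real ^ 'j \<Rightarrow> bool" where
  "block_local_min F X N xs ns \<longleftrightarrow>
     xs \<in> X \<and> ns \<in> N \<and>
     is_arg_min (\<lambda>x. F x ns) (\<lambda>x. x \<in> X) xs \<and>
     (\<exists>\<epsilon>>0. \<forall>n\<in>N. norm (n - ns) < \<epsilon> \<longrightarrow> F xs ns \<le> F xs n)"

text \<open>The lexicographic tie-break determines a unique minimiser, so the definite description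
  in \<open>T_map\<close> denotes.\<close>

lemma finite_bin_set: "finite (bin_set p :: (real ^ 'i::finite) set)"
proof (rule finite_subset)
  show "(bin_set p :: (real ^ 'i) set) \<subseteq> vec_lambda ` (UNIV \<rightarrow>\<^sub>E {0, 1})"
  proof
    fix x :: "real ^ 'i" assume "x \<in> bin_set p"
    then have "(\<lambda>i. x $ i) \<in> UNIV \<rightarrow>\<^sub>E {0, 1}"
      by (auto simp: bin_set_def PiE_def)
    moreover have "x = vec_lambda (\<lambda>i. x $ i)" by simp
    ultimately show "x \<in> vec_lambda ` (UNIV \<rightarrow>\<^sub>E {0, 1})" by blast
  qed
  show "finite (vec_lambda ` (UNIV \<rightarrow>\<^sub>E {0, 1 :: real}) :: (real ^ 'i) set)"
    by (intro finite_imageI finite_PiE) auto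
qed

lemma lex_preferred_total:
  fixes x y :: "real ^ ('i::{finite,linorder})"
  assumes "\<forall>i. x $ i \<in> {0, 1}" "\<forall>i. y $ i \<in> {0, 1}" "x \<noteq> y"
  shows "lex_preferred x y \<or> lex_preferred y x"
proof -
  let ?D = "{i. x $ i \<noteq> y $ i}"
  have "?D \<noteq> {}" using assms(3) by (auto simp: vec_eq_iff)
  then have m: "Min ?D \<in> ?D" by (intro Min_in) auto
  have less: "x $ i = y $ i" if "i < Min ?D" for i
  proof (rule ccontr)
    assume "x $ i \<noteq> y $ i"
    then have "Min ?D \<le> i" by (intro Min_le) auto
    with that show False by simp
  qed
  have "x $ Min ?D \<in> {0, 1}" "y $ Min ?D \<in> {0, 1}" using assms by blast+
  with m consider "x $ Min ?D = 1 \<and> y $ Min ?D = 0" | "y $ Min ?D = 1 \<and> x $ Min ?D = 0"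
    by fastforce
  then show ?thesis
    unfolding lex_preferred_def using less by cases (metis, metis)
qed

lemma lex_preferred_asym: "lex_preferred x y \<Longrightarrow> \<not> lex_preferred y x"
  unfolding lex_preferred_def
  by (metis linorder_neqE zero_neq_one)

lemma lex_preferred_trans:
  assumes "lex_preferred x y" "lex_preferred y z"
  shows "lex_preferred x z"
proof -
  obtain i where i: "x $ i = 1" "y $ i = 0" "\<forall>i'<i. x $ i' = y $ i'"
    using assms(1) unfolding lex_preferred_def by blast
  obtain j where j: "y $ j = 1" "z $ j = 0" "\<forall>i'<j. y $ i' = z $ i'"
    using assms(2) unfolding lex_preferred_def by blast
  have "i \<noteq> j" using i(2) j(1) by auto
  then consider "i < j" | "j < i" by (meson linorder_neqE)
  then show ?thesis
  proof cases
    case 1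
    have "z $ i = 0" using 1 i(2) j(3) by auto
    moreover have "x $ k = z $ k" if "k < i" for k
    proof -
      have "k < i" "k < j" using that 1 by (auto intro: order.strict_trans)
      then have "x $ k = y $ k" "y $ k = z $ k" using i(3) j(3) by blast+
      then show ?thesis by simp
    qed
    ultimately show ?thesis unfolding lex_preferred_def using i(1) by blast
  next
    case 2
    have "x $ j = 1" using 2 i(3) j(1) by auto
    moreover have "x $ k = z $ k" if "k < j" for k
    proof -
      have "k < i" "k < j" using that 2 by (auto intro: order.strict_trans)
      then have "x $ k = y $ k" "y $ k = z $ k" using i(3) j(3) by blast+
      then show ?thesis by simp
    qed
    ultimately show ?thesis unfolding lex_preferred_def using j(2) by blast
  qed
qed

lemma lex_preferred_greatest:
  fixes A :: "(real ^ ('i::{finite,linorder})) set"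
  assumes "finite A" "A \<noteq> {}" "\<And>x. x \<in> A \<Longrightarrow> \<forall>i. x $ i \<in> {0, 1}"
  shows "\<exists>!x. x \<in> A \<and> (\<forall>y\<in>A. y \<noteq> x \<longrightarrow> lex_preferred x y)"
proof -
  have "\<exists>x. x \<in> A \<and> (\<forall>y\<in>A. y \<noteq> x \<longrightarrow> lex_preferred x y)"
    using assms
  proof (induction A rule: finite_ne_induct)
    case (singleton a)
    then show ?case by simp
  next
    case (insert a A)
    then obtain x where x: "x \<in> A" "\<forall>y\<in>A. y \<noteq> x \<longrightarrow> lex_preferred x y" by auto
    have "x \<noteq> a" using x(1) insert.hyps by blast
    then have "lex_preferred x a \<or> lex_preferred a x"
      using insert.prems x(1) by (intro lex_preferred_total) auto
    then show ?case
    proof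
      assume "lex_preferred x a"
      then show ?thesis using x by blast
    next
      assume "lex_preferred a x"
      have "lex_preferred a y" if "y \<in> A" for y
      proof (cases "y = x")
        case False
        then have "lex_preferred x y" using x(2) that by blast
        with \<open>lex_preferred a x\<close> show ?thesis by (rule lex_preferred_trans)
      qed (use \<open>lex_preferred a x\<close> in simp)
      then show ?thesis by blast
    qed
  qed
  then obtain x where x: "x \<in> A" "\<forall>y\<in>A. y \<noteq> x \<longrightarrow> lex_preferred x y" by blast
  have "y = x" if "y \<in> A" "\<forall>z\<in>A. z \<noteq> y \<longrightarrow> lex_preferred y z" for y
  proof (rule ccontr)
    assume "y \<noteq> x"
    then have "lex_preferred x y" "lex_preferred y x" using x that by auto
    then show False by (meson lex_preferred_asym)
  qed
  then show ?thesis using x by metis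
qed

lemma T_map_is_arg_min:
  fixes P :: "real ^ ('i::{finite,linorder}) \<Rightarrow> real ^ 'j::finite \<Rightarrow> real"
  assumes "0 \<le> p"
  shows "is_arg_min (\<lambda>x. P x n) (\<lambda>x. x \<in> bin_set p) (T_map P (bin_set p) n)"
    and "\<And>y. is_arg_min (\<lambda>x. P x n) (\<lambda>x. x \<in> bin_set p) y \<Longrightarrow> y \<noteq> T_map P (bin_set p) n
           \<Longrightarrow> lex_preferred (T_map P (bin_set p) n) y"
proof -
  let ?A = "{x. is_arg_min (\<lambda>x. P x n) (\<lambda>x. x \<in> bin_set p) x}"
  have sub: "?A \<subseteq> bin_set p" by (auto simp: is_arg_min_def)
  have "(0 :: real ^ ('i::{finite,linorder})) \<in> bin_set p" using assms by (simp add: bin_set_def)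
  then have "?A \<noteq> {}"
    using ex_is_arg_min_if_finite[OF finite_bin_set, of p "\<lambda>x. P x n"] by blast
  moreover have "finite ?A" using sub finite_bin_set finite_subset by blast
  moreover have "\<forall>i. x $ i \<in> {0, 1}" if "x \<in> ?A" for x
    using sub that unfolding bin_set_def by blast
  ultimately have "\<exists>!x. x \<in> ?A \<and> (\<forall>y\<in>?A. y \<noteq> x \<longrightarrow> lex_preferred x y)"
    by (intro lex_preferred_greatest) auto
  then have ex: "\<exists>!x. is_arg_min (\<lambda>x. P x n) (\<lambda>x. x \<in> bin_set p) x \<and>
        (\<forall>y. is_arg_min (\<lambda>x. P x n) (\<lambda>x. x \<in> bin_set p) y \<and> y \<noteq> x \<longrightarrow> lex_preferred x y)"
    by (simp only: mem_Collect_eq Ball_def imp_conjL)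
  have T: "is_arg_min (\<lambda>x. P x n) (\<lambda>x. x \<in> bin_set p) (T_map P (bin_set p) n) \<and>
        (\<forall>y. is_arg_min (\<lambda>x. P x n) (\<lambda>x. x \<in> bin_set p) y \<and> y \<noteq> T_map P (bin_set p) n
          \<longrightarrow> lex_preferred (T_map P (bin_set p) n) y)"
    unfolding T_map_def by (rule theI'[OF ex])
  show "is_arg_min (\<lambda>x. P x n) (\<lambda>x. x \<in> bin_set p) (T_map P (bin_set p) n)"
    using T by blast
  show "\<And>y. is_arg_min (\<lambda>x. P x n) (\<lambda>x. x \<in> bin_set p) y \<Longrightarrow> y \<noteq> T_map P (bin_set p) n
           \<Longrightarrow> lex_preferred (T_map P (bin_set p) n) y"
    using T by blast
qed

end

theory Submission
  imports Defs
begin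

text \<open>
  For fixed \<open>x\<close> the objective is a continuous convex function of \<open>n\<close>, and this is the whole point.
  The map \<open>s \<mapsto> s \<Psi>(a / s)\<close> on \<open>(0, \<infinity>)\<close> is the perspective of \<open>\<Psi>\<close>. Since \<open>\<Psi>' = \<Phi>\<close>, its derivative
  is \<open>\<Psi>(z) - z \<Phi>(z) = \<phi>(z)\<close> at \<open>z = a / s\<close>. This is positive, and it does not decrease with \<open>s\<close>,
  because \<open>\<bar>z\<bar>\<close> does not grow; so the perspective is increasing and convex, and it stays convex in \<open>n\<close> after
  substituting the convex function \<open>h\<close> for \<open>s\<close> (\<open>convex_on_perspective_compose\<close>). The objective
  is a positive combination of such terms plus an affine function.

  By local stability \<open>x\<close> is eventually a constant \<open>xs\<close>, so the tail of \<open>n\<close> is a run of the proximal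
  point method for the single convex function \<open>F(xs, \<cdot>)\<close>. Each step satisfies
  \<open>f(v) - f(u) \<le> \<lambda>/2 (\<parallel>u - c\<parallel>\<^sup>2 - \<parallel>u - v\<parallel>\<^sup>2)\<close> for every feasible \<open>u\<close>, where \<open>c\<close> is the old and \<open>v\<close> the
  new iterate (\<open>prox_step_inequality\<close>). If the limit were worse than some \<open>u\<close> by a positive
  gap, dividing by \<open>\<lambda>\<close> and telescoping would make \<open>\<Sum> 1/\<lambda>\<close> converge, against the hypothesis
  (\<open>prox_limit_minimizes\<close>). So the limit minimises \<open>F(xs, \<cdot>)\<close> over the whole box, not only near
  the limit. Optimality of \<open>xs\<close> at the limit follows by continuity of \<open>F(y, \<cdot>)\<close> for each \<open>y\<close>.
\<close>

section \<open>The function \<Psi> and its perspective\<close>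

text \<open>To the right of any base point the distribution function differs by a constant from the
  integral of \<open>f\<close> started there. Near \<open>t\<close> the base point \<open>t - 1\<close> serves, so the fundamental theorem on
  a compact interval is enough.\<close>

lemma has_real_derivative_cdf_density:
  fixes f :: "real \<Rightarrow> real"
  assumes dist: "real_distribution (density lborel f)"
    and cont: "continuous_on UNIV f" and nonneg: "\<And>x. 0 \<le> f x"
  shows "(cdf (density lborel f) has_real_derivative f t) (at t)"
proof -
  let ?M = "density lborel f"
  interpret real_distribution ?M by (rule dist)
  have meas: "f \<in> borel_measurable borel"
    using cont by (rule borel_measurable_continuous_onI)
  have eq: "cdf ?M (t - 1) + integral {t - 1..y} f = cdf ?M y" if "t - 1 < y" for y
  proof -
    have int: "set_integrable lborel {t - 1..y} f"
      by (intro borel_integrable_atLeastAtMost' continuous_on_subset[OF cont]) simp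
    have intg: "integrable lborel (\<lambda>x. indicator {t - 1<..y} x * f x)"
      using set_integrable_subset[OF int, of "{t - 1<..y}"]
      by (simp add: set_integrable_def greaterThanAtMost_subseteq_atLeastAtMost_iff)
    have "emeasure ?M {t - 1<..y} = (\<integral>\<^sup>+x. ennreal (indicator {t - 1<..y} x * f x) \<partial>lborel)"
      using meas by (subst emeasure_density)
        (auto intro!: nn_integral_cong split: split_indicator)
    also have "\<dots> = ennreal (LINT x|lborel. indicator {t - 1<..y} x * f x)"
      using intg nonneg by (intro nn_integral_eq_integral) auto
    finally have "measure ?M {t - 1<..y} = (LINT x|lborel. indicator {t - 1<..y} x * f x)"
      using nonneg by (simp add: measure_def)
    also have "\<dots> = integral {t - 1<..y} f"
      using set_borel_integral_eq_integral(2)[of "{t - 1<..y}" f] intg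
      by (simp add: set_integrable_def set_lebesgue_integral_def)
    also have "\<dots> = integral {t - 1..y} f"
      by (rule integral_spike_set; rule negligible_subset[of "{t - 1}"]) auto
    finally show ?thesis using cdf_diff_eq[OF that] by simp
  qed
  have "((\<lambda>y. integral {t - 1..y} f) has_real_derivative f t) (at t within {t - 1..t + 1})"
    by (intro integral_has_real_derivative continuous_on_subset[OF cont]) auto
  then have "((\<lambda>y. cdf ?M (t - 1) + integral {t - 1..y} f) has_real_derivative f t) (at t)"
    by (subst (asm) at_within_Icc_at) (auto intro!: derivative_eq_intros)
  then show ?thesis
    by (rule has_field_derivative_transform_within_open[of _ _ _ "{t - 1<..}"]) (auto simp: eq)
qed

lemma Psi_has_real_derivative:
  "(Psi has_real_derivative cdf std_normal_distribution z) (at z)"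
proof -
  have "(cdf std_normal_distribution has_real_derivative std_normal_density z) (at z)"
    by (intro has_real_derivative_cdf_density real_dist_normal_dist)
      (auto simp: std_normal_density_def intro!: continuous_intros)
  moreover have "(std_normal_density has_real_derivative - z * std_normal_density z) (at z)"
    unfolding std_normal_density_def[abs_def]
    by (rule derivative_eq_intros refl | simp)+
  ultimately show ?thesis
    unfolding Psi_def[abs_def] by (auto intro!: derivative_eq_intros)
qed

lemma continuous_on_Psi: "continuous_on S Psi"
  using Psi_has_real_derivative by (meson DERIV_continuous_on has_field_derivative_at_within)

text \<open>The two terms with \<open>\<Phi>\<close> cancel in the derivative of the perspective: only the density remains.\<close>

lemma perspective_Psi_has_real_derivative:
  assumes "0 < s"
  shows "((\<lambda>s. s * Psi (a / s)) has_real_derivative std_normal_density (a / s)) (at s)"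
proof -
  have "((\<lambda>s. Psi (a / s)) has_real_derivative
      cdf std_normal_distribution (a / s) * (- a / s\<^sup>2)) (at s)"
    using assms
    by (intro DERIV_chain2[OF Psi_has_real_derivative])
      (auto intro!: derivative_eq_intros simp: power2_eq_square)
  then have "((\<lambda>s. s * Psi (a / s)) has_real_derivative
      1 * Psi (a / s) + (cdf std_normal_distribution (a / s) * (- a / s\<^sup>2)) * s) (at s)"
    by (intro DERIV_mult DERIV_ident)
  moreover have "1 * Psi (a / s) + (cdf std_normal_distribution (a / s) * (- a / s\<^sup>2)) * s
      = std_normal_density (a / s)"
    using assms by (simp add: Psi_def power2_eq_square)
  ultimately show ?thesis by metis
qed

lemma std_normal_density_antimono_abs:
  "\<bar>y\<bar> \<le> \<bar>z\<bar> \<Longrightarrow> std_normal_density z \<le> std_normal_density y"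
  by (simp add: std_normal_density_def divide_right_mono flip: abs_le_square_iff)

lemma convex_on_perspective_Psi: "convex_on {0<..} (\<lambda>s. s * Psi (a / s))"
proof (rule convex_on_realI[OF _ perspective_Psi_has_real_derivative])
  fix s t :: real assume "s \<in> {0<..}" "t \<in> {0<..}" "s \<le> t"
  then have "\<bar>a / t\<bar> \<le> \<bar>a / s\<bar>" by (auto simp: abs_divide intro!: divide_left_mono)
  then show "std_normal_density (a / s) \<le> std_normal_density (a / t)"
    by (rule std_normal_density_antimono_abs)
qed auto

lemma mono_on_perspective_Psi: "mono_on {0<..} (\<lambda>s. s * Psi (a / s))"
proof (rule mono_onI)
  fix s t :: real assume st: "s \<in> {0<..}" "t \<in> {0<..}" "s \<le> t"
  show "s * Psi (a / s) \<le> t * Psi (a / t)"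
    using st(3)
  proof (rule DERIV_nonneg_imp_nondecreasing)
    fix u assume "s \<le> u" "u \<le> t"
    then show "\<exists>y. ((\<lambda>s. s * Psi (a / s)) has_real_derivative y) (at u) \<and> 0 \<le> y"
      using st perspective_Psi_has_real_derivative[of u a] normal_density_nonneg by fastforce
  qed
qed

section \<open>Convexity and continuity of the objective in n\<close>

lemma convex_on_mono_compose:
  fixes f :: "'a::real_vector \<Rightarrow> real" and \<phi> :: "real \<Rightarrow> real"
  assumes f: "convex_on S f" "f ` S \<subseteq> T" and \<phi>: "convex_on T \<phi>" "mono_on T \<phi>"
  shows "convex_on S (\<lambda>x. \<phi> (f x))"
proof (rule convex_onI)
  show "convex S" using f(1) by (rule convex_on_imp_convex)
  fix t :: real and x y assume t: "0 < t" "t < 1" and xy: "x \<in> S" "y \<in> S"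
  let ?z = "(1 - t) *\<^sub>R x + t *\<^sub>R y"
  have T: "convex T" using \<phi>(1) by (rule convex_on_imp_convex)
  have fz: "f ?z \<in> T" and fxy: "f x \<in> T" "f y \<in> T"
    using f(2) xy t convexD_alt[OF \<open>convex S\<close> xy, of t] by auto
  have "(1 - t) * f x + t * f y \<in> T"
    using convexD_alt[OF T fxy, of t] t by simp
  moreover have "f ?z \<le> (1 - t) * f x + t * f y"
    using convex_onD[OF f(1), of t x y] t xy by simp
  ultimately have "\<phi> (f ?z) \<le> \<phi> ((1 - t) * f x + t * f y)"
    by (intro mono_onD[OF \<phi>(2)] fz)
  also have "\<dots> \<le> (1 - t) * \<phi> (f x) + t * \<phi> (f y)"
    using convex_onD[OF \<phi>(1), of t "f x" "f y"] t fxy by simp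
  finally show "\<phi> (f ?z) \<le> (1 - t) * \<phi> (f x) + t * \<phi> (f y)" .
qed

lemma convex_on_sum_functions:
  assumes "finite I" "convex S" "\<And>i. i \<in> I \<Longrightarrow> convex_on S (f i)"
  shows "convex_on S (\<lambda>x. \<Sum>i\<in>I. f i x)"
  using assms by (induction I rule: finite_induct) (auto simp: convex_on_const intro: convex_on_add)

lemma strictly_convex_on_imp_convex_on:
  assumes "strictly_convex_on S f"
  shows "convex_on S f"
proof (rule convex_onI)
  fix t x y :: real assume "0 < t" "t < 1" "x \<in> S" "y \<in> S"
  show "f ((1 - t) *\<^sub>R x + t *\<^sub>R y) \<le> (1 - t) * f x + t * f y"
  proof (cases "x = y")
    case False
    with assms have "f ((1 - t) * x + t * y) < (1 - t) * f x + t * f y"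
      using \<open>0 < t\<close> \<open>t < 1\<close> \<open>x \<in> S\<close> \<open>y \<in> S\<close> by (simp add: strictly_convex_on_def)
    then show ?thesis by simp
  qed (simp add: algebra_simps)
qed (use assms in \<open>simp add: strictly_convex_on_def\<close>)

text \<open>Monotonicity of the perspective is what allows \<open>f\<close> to be merely convex instead of affine. The
  sum stays inside the factor \<open>f x\<close> to match the shape of the objective.\<close>

lemma convex_on_perspective_compose:
  fixes f :: "'a::real_vector \<Rightarrow> real"
  assumes "convex_on S f" "\<And>x. x \<in> S \<Longrightarrow> 0 < f x" "\<And>i. i \<in> I \<Longrightarrow> 0 \<le> w i" "finite I"
  shows "convex_on S (\<lambda>x. f x * (\<Sum>i\<in>I. w i * Psi (a i / f x)))"
proof -
  have "convex_on S (\<lambda>x. \<Sum>i\<in>I. w i * (f x * Psi (a i / f x)))"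
  proof (intro convex_on_sum_functions convex_on_cmul)
    show "convex_on S (\<lambda>x. f x * Psi (a i / f x))" for i
      by (rule convex_on_mono_compose[OF assms(1) _ convex_on_perspective_Psi
            mono_on_perspective_Psi]) (use assms(2) in auto)
  qed (use assms convex_on_imp_convex in auto)
  then show ?thesis by (simp add: sum_distrib_left mult.left_commute)
qed

lemma box_set_eq_cbox: "box_set b = cbox 0 (\<chi> j. b)"
  by (auto simp: box_set_def mem_box_cart)

lemma h_conditions_convex_on:
  "h_conditions S h \<Longrightarrow> s \<in> S \<Longrightarrow> convex_on {0..} (\<lambda>n. h n s)"
  by (auto simp: h_conditions_def intro: strictly_convex_on_imp_convex_on)

lemma h_conditions_continuous_on:
  "h_conditions S h \<Longrightarrow> s \<in> S \<Longrightarrow> continuous_on {0..} (\<lambda>n. h n s)"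
  unfolding h_conditions_def C1_on_def by (meson DERIV_continuous_on)

lemma h_conditions_pos:
  "h_conditions S h \<Longrightarrow> s \<in> S \<Longrightarrow> 0 \<le> n \<Longrightarrow> 0 < h n s"
  by (simp add: h_conditions_def)

lemma convex_on_vec_nth_box:
  fixes h :: "real \<Rightarrow> real"
  assumes "convex_on {0..} h"
  shows "convex_on (box_set b) (\<lambda>n :: real ^ 'j::finite. h (n $ j))"
proof (rule convex_onI)
  fix t :: real and m n :: "real ^ 'j"
  assume "0 < t" "t < 1" "m \<in> box_set b" "n \<in> box_set b"
  then show "h (((1 - t) *\<^sub>R m + t *\<^sub>R n) $ j) \<le> (1 - t) * h (m $ j) + t * h (n $ j)"
    using convex_onD[OF assms, of t "m $ j" "n $ j"] by (simp add: box_set_def)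
qed (simp add: box_set_eq_cbox)

lemma convex_on_F_obj:
  fixes d \<sigma> :: "real ^ 'j::finite"
  assumes "\<And>i j. 0 \<le> q i j" "\<And>j. h_conditions (S j) (h j)" "\<And>j. \<sigma> $ j \<in> S j"
  shows "convex_on (box_set b) (F_obj e d r q g h \<sigma> x)"
proof -
  have conv: "convex (box_set b :: (real ^ 'j) set)" by (simp add: box_set_eq_cbox)
  have "convex_on (box_set b) (\<lambda>n. d \<bullet> n)"
    using conv by (intro convex_onI) (simp_all add: inner_add_right)
  then show ?thesis
    unfolding F_obj_def[abs_def]
    by (intro convex_on_add convex_on_sum_functions convex_on_perspective_compose
        convex_on_vec_nth_box[OF h_conditions_convex_on[OF assms(2,3)]])
      (use conv assms(1) in \<open>auto simp: convex_on_const box_set_def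
         intro!: h_conditions_pos[OF assms(2,3)]\<close>)
qed

lemma continuous_on_F_obj:
  fixes d \<sigma> :: "real ^ 'j::finite"
  assumes "\<And>j. h_conditions (S j) (h j)" "\<And>j. \<sigma> $ j \<in> S j"
  shows "continuous_on (box_set b) (F_obj e d r q g h \<sigma> x)"
proof -
  have h: "continuous_on (box_set b) (\<lambda>n. h j (n $ j) (\<sigma> $ j))" for j
    by (rule continuous_on_compose2[OF h_conditions_continuous_on[OF assms]])
      (auto simp: box_set_def intro!: continuous_intros)
  have "h j (n $ j) (\<sigma> $ j) \<noteq> 0" if "n \<in> box_set b" for j n
    using h_conditions_pos[OF assms, of "n $ j" j] that by (force simp: box_set_def)
  then show ?thesis
    unfolding F_obj_def[abs_def]
    by (intro continuous_intros h continuous_on_compose2[OF continuous_on_Psi[of UNIV]]) auto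
qed

section \<open>The proximal point method\<close>

text \<open>Compare the new iterate \<open>v\<close> with the points \<open>v + t (u - v)\<close> of the segment to \<open>u\<close> and let
  \<open>t \<rightarrow> 0\<close>: this gives \<open>f v - f u \<le> l \<langle>u - v, v - c\<rangle>\<close>, and twice the inner product is
  \<open>\<parallel>u - c\<parallel>\<^sup>2 - \<parallel>u - v\<parallel>\<^sup>2 - \<parallel>v - c\<parallel>\<^sup>2\<close>. The last square is dropped, so that the bound telescopes along
  the iterates.\<close>

lemma prox_step_inequality:
  fixes f :: "'a::real_inner \<Rightarrow> real"
  assumes f: "convex_on N f" and l: "0 \<le> l" and u: "u \<in> N"
    and v: "is_arg_min (\<lambda>m. f m + l / 2 * (norm (m - c))\<^sup>2) (\<lambda>m. m \<in> N) v"
  shows "f v - f u \<le> l / 2 * ((norm (u - c))\<^sup>2 - (norm (u - v))\<^sup>2)"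
proof -
  let ?I = "(u - v) \<bullet> (v - c)"
  have vN: "v \<in> N" using v by (simp add: is_arg_min_linorder)
  have bound: "f v - f u \<le> l * ?I + t * (l / 2 * (norm (u - v))\<^sup>2)" if t: "0 < t" "t < 1" for t
  proof -
    let ?w = "(1 - t) *\<^sub>R v + t *\<^sub>R u"
    have "?w \<in> N"
      using convexD_alt[OF convex_on_imp_convex[OF f] vN u, of t] t by simp
    then have opt: "f v + l / 2 * (norm (v - c))\<^sup>2 \<le> f ?w + l / 2 * (norm (?w - c))\<^sup>2"
      using v by (simp add: is_arg_min_linorder)
    have conv: "f ?w \<le> (1 - t) * f v + t * f u"
      using convex_onD[OF f, of t v u] t vN u by simp
    have norm_eq: "(norm (?w - c))\<^sup>2 = (norm (v - c))\<^sup>2 + 2 * t * ?I + t\<^sup>2 * (norm (u - v))\<^sup>2"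
    proof -
      have "?w - c = (v - c) + t *\<^sub>R (u - v)" by (simp add: algebra_simps)
      then show ?thesis
        by (simp only: power2_norm_eq_inner)
          (simp add: inner_add inner_commute power2_eq_square del: inner_diff_left inner_diff_right)
    qed
    have "f v + l / 2 * (norm (v - c))\<^sup>2 \<le> (1 - t) * f v + t * f u
        + l / 2 * ((norm (v - c))\<^sup>2 + 2 * t * ?I + t\<^sup>2 * (norm (u - v))\<^sup>2)"
      using opt conv unfolding norm_eq by (rule order_trans[OF _ add_right_mono])
    also have "\<dots> = f v + l / 2 * (norm (v - c))\<^sup>2 - t * (f v - f u)
        + t * (l * ?I + t * (l / 2 * (norm (u - v))\<^sup>2))"
      by algebra
    finally have "t * (f v - f u) \<le> t * (l * ?I + t * (l / 2 * (norm (u - v))\<^sup>2))"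
      by linarith
    then show ?thesis using t by simp
  qed
  have "((\<lambda>t. l * ?I + t * (l / 2 * (norm (u - v))\<^sup>2)) \<longlongrightarrow> l * ?I + 0 * (l / 2 * (norm (u - v))\<^sup>2))
      (at_right 0)"
    by (intro tendsto_intros)
  moreover have "\<forall>\<^sub>F t in at_right 0. f v - f u \<le> l * ?I + t * (l / 2 * (norm (u - v))\<^sup>2)"
    using eventually_at_right_real[OF zero_less_one] by eventually_elim (rule bound; simp)
  ultimately have "f v - f u \<le> l * ?I"
    using tendsto_lowerbound[of _ _ "at_right (0::real)" "f v - f u"] by simp
  also have "l * ?I = l / 2 * ((norm (u - c))\<^sup>2 - (norm (u - v))\<^sup>2) - l / 2 * (norm (v - c))\<^sup>2"
    by (simp add: power2_norm_eq_inner algebra_simps inner_commute)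
  also have "\<dots> \<le> l / 2 * ((norm (u - c))\<^sup>2 - (norm (u - v))\<^sup>2)"
    using l by simp
  finally show ?thesis .
qed

text \<open>Divergence of \<open>\<Sum> 1/\<lambda>\<close> keeps the steps from dying out before a minimiser is reached: with
  quickly growing \<open>\<lambda>\<close> the iterates can converge to a point that is not a minimiser.\<close>

lemma prox_limit_minimizes:
  fixes f :: "'a::real_inner \<Rightarrow> real"
  assumes f: "convex_on N f" "continuous_on N f"
    and lim: "n \<longlonglongrightarrow> ns" "ns \<in> N" "\<And>k. n k \<in> N"
    and lam: "\<And>k. 0 < lam k" "\<not> summable (\<lambda>k. 1 / lam k)"
    and step: "\<forall>\<^sub>F k in sequentially. is_arg_min (\<lambda>m. f m + lam k / 2 * (norm (m - n k))\<^sup>2)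
                 (\<lambda>m. m \<in> N) (n (Suc k))"
    and u: "u \<in> N"
  shows "f ns \<le> f u"
proof (rule ccontr)
  assume "\<not> f ns \<le> f u"
  define \<delta> where "\<delta> = (f ns - f u) / 2"
  have \<delta>: "0 < \<delta>" "f u + \<delta> < f ns"
    using \<open>\<not> f ns \<le> f u\<close> by (simp_all add: \<delta>_def field_simps)
  have "(\<lambda>k. f (n (Suc k))) \<longlonglongrightarrow> f ns"
    using continuous_on_tendsto_compose[OF f(2) lim(1,2)] lim(3) by (intro LIMSEQ_Suc) simp
  then have gap: "\<forall>\<^sub>F k in sequentially. f u + \<delta> < f (n (Suc k))"
    using \<delta>(2) by (rule order_tendstoD(1))
  let ?a = "\<lambda>k. (norm (u - n k))\<^sup>2"
  have "?a \<longlonglongrightarrow> (norm (u - ns))\<^sup>2"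
    by (intro tendsto_intros lim)
  then have "summable (\<lambda>k. 1 / (2 * \<delta>) * (?a k - ?a (Suc k)))"
    by (intro summable_mult telescope_summable')
  then have "summable (\<lambda>k. 1 / lam k)"
  proof (rule summable_comparison_test_ev[rotated])
    show "\<forall>\<^sub>F k in sequentially. norm (1 / lam k) \<le> 1 / (2 * \<delta>) * (?a k - ?a (Suc k))"
      using gap step
    proof eventually_elim
      case (elim k)
      have "\<delta> \<le> f (n (Suc k)) - f u" using elim by simp
      also have "\<dots> \<le> lam k / 2 * (?a k - ?a (Suc k))"
        using lam(1)[of k] by (intro prox_step_inequality[OF f(1) _ u elim(2)]) simp
      finally show ?case using \<delta>(1) lam(1)[of k] by (simp add: field_simps)
    qed
  qed
  with lam(2) show False by contradiction
qed

section \<open>Convergence to a local minimum\<close>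

theorem theorem3:
  fixes e b p :: real
    and d \<sigma> :: "real ^ 'j::finite"
    and r :: "real ^ ('i::{finite,linorder})"
    and q :: "'i \<Rightarrow> 'j \<Rightarrow> real"
    and g :: "'i \<Rightarrow> 'j \<Rightarrow> real ^ ('i::{finite,linorder}) \<Rightarrow> real"
    and h :: "'j \<Rightarrow> real \<Rightarrow> real \<Rightarrow> real"
    and S :: "'j \<Rightarrow> real set"
    and lam :: "nat \<Rightarrow> real"
    and x :: "nat \<Rightarrow> real ^ ('i::{finite,linorder})"
    and n :: "nat \<Rightarrow> real ^ 'j"
  assumes "b > 0"
    and "\<And>i j. q i j > 0"
    and "\<And>i j. affine_fun (g i j)"
    and "\<And>j. open (S j)"
    and "\<And>j. h_conditions (S j) (h j)"
    and "\<And>j. \<sigma> $ j \<in> S j"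
    and "\<And>k. lam k > 0"
    and "\<not> summable (\<lambda>k. 1 / lam k)"
    and "prox_bcd (F_obj e d r q g h \<sigma>) (F_obj e d r q g h \<sigma>) (bin_set p) (box_set b) lam x n"
    and "convergent n"
    and "local_stability (F_obj e d r q g h \<sigma>) (bin_set p) n"
  shows "\<exists>xs ns. (\<lambda>k. (x k, n k)) \<longlonglongrightarrow> (xs, ns) \<and>
           block_local_min (F_obj e d r q g h \<sigma>) (bin_set p) (box_set b) xs ns"
proof -
  let ?F = "F_obj e d r q g h \<sigma>" and ?X = "bin_set p" and ?N = "box_set b"
  note alg = assms(9)[unfolded prox_bcd_def]
  obtain ns where ns: "n \<longlonglongrightarrow> ns" using assms(10) by (auto simp: convergent_def)
  then obtain xs K where xs: "xs \<in> ?X" and K: "\<And>k. k > K \<Longrightarrow> xs = T_map ?F ?X (n k)"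
      "\<And>k. k > K \<Longrightarrow> is_arg_min (\<lambda>y. ?F y (n k)) (\<lambda>y. y \<in> ?X) xs"
    using assms(11) unfolding local_stability_def by meson
  have xk: "x (Suc k) = xs" if "k > K" for k using alg K(1)[OF that] by simp
  have nN: "n k \<in> ?N" for k
    using alg by (cases k) (auto simp: is_arg_min_linorder)
  have nsN: "ns \<in> ?N"
    by (rule closed_sequentially[OF _ nN ns]) (simp add: box_set_eq_cbox closed_cbox)
  have cont: "continuous_on ?N (?F y)" for y
    by (rule continuous_on_F_obj[OF assms(5,6)])
  have Flim: "(\<lambda>k. ?F y (n k)) \<longlonglongrightarrow> ?F y ns" for y
    using continuous_on_tendsto_compose[OF cont ns nsN] nN by simp

  have "(\<lambda>k. x (Suc k)) \<longlonglongrightarrow> xs"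
    by (rule tendsto_eventually, use eventually_gt_at_top[of K] in eventually_elim) (rule xk)
  then have "(\<lambda>k. (x k, n k)) \<longlonglongrightarrow> (xs, ns)"
    using ns by (intro tendsto_Pair) (auto simp: filterlim_sequentially_Suc)
  moreover have "?F xs ns \<le> ?F y ns" if "y \<in> ?X" for y
    using Flim[of xs] Flim[of y]
  proof (rule LIMSEQ_le)
    show "\<exists>k0. \<forall>k\<ge>k0. ?F xs (n k) \<le> ?F y (n k)"
      using K(2) that by (intro exI[of _ "Suc K"]) (auto simp: is_arg_min_linorder)
  qed
  moreover have "?F xs ns \<le> ?F xs m" if "m \<in> ?N" for m
  proof (rule prox_limit_minimizes[OF _ cont ns nsN nN assms(7,8) _ that])
    show "convex_on ?N (?F xs)"
      by (rule convex_on_F_obj[OF less_imp_le[OF assms(2)] assms(5,6)])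
    show "\<forall>\<^sub>F k in sequentially. is_arg_min (\<lambda>m. ?F xs m + lam k / 2 * (norm (m - n k))\<^sup>2)
        (\<lambda>m. m \<in> ?N) (n (Suc k))"
      using eventually_gt_at_top[of K]
    proof eventually_elim
      case (elim k)
      have "is_arg_min (\<lambda>m. ?F (x (Suc k)) m + lam k / 2 * (norm (m - n k))\<^sup>2)
          (\<lambda>m. m \<in> ?N) (n (Suc k))"
        using alg by blast
      then show ?case by (simp only: xk[OF elim])
    qed
  qed
  ultimately have "block_local_min ?F ?X ?N xs ns"
    using xs nsN zero_less_one unfolding block_local_min_def is_arg_min_linorder by blast
  with \<open>(\<lambda>k. (x k, n k)) \<longlonglongrightarrow> (xs, ns)\<close> show ?thesis by blast
qed

end
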